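(* For any nontrivial hypergraph $H$, \[ \frac{1}{k_f(H^* )} + \frac{1}{k_f(\overline{H})} = 1. \]
   Context: A (finite) hypergraph is a pair $H=(V,E)$ with $V$ a finite set of vertices and $E$ a finite multiset of edges, each a subset of $V$. A vertex is universal if it belongs to all edges. $H$ is nontrivial if it has no empty edge and no universal vertex. The fractional covering number $k_f(H)$ is the optimal value of the LP $\min \sum_{e\in E} x_e$ subject to $\sum_{e \ni v} x_e \ge 1$ for all $v\in V$ and $x_e \ge 0$ for all $e \in E$. The dual hypergraph of $H=(V,E)$ is $H^* = (E, \{\{e \in E : e \ni v\} : v \in V\})$ (vertices are the edges of $H$, and for each vertex $v$ of $H$ there is an edge consisting of the edges of $H$ containing $v$). The complement of $H$ is $\overline{H} = (V, \{V\setminus e : e \in E\})$ (as a multiset). *)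

theory Defs
  imports Complex_Main "HOL-Library.Multiset" "HOL-Library.Extended_Real"
begin

datatype 'v hypergraph = Hypergraph (verts: "'v set") (edges: "'v set multiset")

definition hypergraph :: "'v hypergraph \<Rightarrow> bool" where
  "hypergraph H \<longleftrightarrow> finite (verts H) \<and> (\<forall>e \<in># edges H. e \<subseteq> verts H)"

definition universal :: "'v hypergraph \<Rightarrow> 'v \<Rightarrow> bool" where
  "universal H v \<longleftrightarrow> v \<in> verts H \<and> (\<forall>e \<in># edges H. v \<in> e)"

definition nontrivial :: "'v hypergraph \<Rightarrow> bool" where
  "nontrivial H \<longleftrightarrow> {} \<notin># edges H \<and> (\<nexists>v. universal H v)"

text \<open>
  The edges form a multiset, and repeated edges count as different edges: each of them has its own
  variable in the linear program and is a vertex of its own in the dual. An occurrence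
  of the edge \<open>e\<close> is written \<open>(e, i)\<close>, where \<open>i\<close> is smaller than the multiplicity of \<open>e\<close>.
\<close>

definition occurrences :: "'v hypergraph \<Rightarrow> ('v set \<times> nat) set" where
  "occurrences H = {(e, i). i < count (edges H) e}"

definition fractional_cover :: "'v hypergraph \<Rightarrow> ('v set \<times> nat \<Rightarrow> real) \<Rightarrow> bool" where
  "fractional_cover H x \<longleftrightarrow>
     (\<forall>v \<in> verts H. (\<Sum>c \<in> {c \<in> occurrences H. v \<in> fst c}. x c) \<ge> 1) \<and>
     (\<forall>c \<in> occurrences H. x c \<ge> 0)"

text \<open>
  The optimal value is \<open>\<infinity>\<close> when the linear program is infeasible, that is, when some vertex lies in
  no edge.
\<close>

definition fractional_covering_number :: "'v hypergraph \<Rightarrow> ereal" where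
  "fractional_covering_number H =
     (INF x \<in> {x. fractional_cover H x}. ereal (\<Sum>c \<in> occurrences H. x c))"

definition dual :: "'v hypergraph \<Rightarrow> ('v set \<times> nat) hypergraph" where
  "dual H = Hypergraph (occurrences H)
     (image_mset (\<lambda>v. {c \<in> occurrences H. v \<in> fst c}) (mset_set (verts H)))"

definition complement :: "'v hypergraph \<Rightarrow> 'v hypergraph" where
  "complement H = Hypergraph (verts H) (image_mset (\<lambda>e. verts H - e) (edges H))"

lemma finite_occurrences: "finite (occurrences H)"
proof -
  have "occurrences H = (SIGMA e : set_mset (edges H). {..<count (edges H) e})"
    by (auto simp: occurrences_def intro: count_inI)
  then show ?thesis
    by simp
qed

lemma hypergraph_dual: "hypergraph (dual H)"
  by (cases "finite (verts H)") (auto simp: hypergraph_def dual_def finite_occurrences)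

lemma hypergraph_complement: "hypergraph H \<Longrightarrow> hypergraph (complement H)"
  by (auto simp: hypergraph_def complement_def)

end

theory Submission imports Defs begin

text \<open>
  Normalising covers to probability distributions, \<open>1 / k\<^sub>f\<close> of the dual is the value, for the player
  choosing vertices, of the game whose payoff is 1 if the vertex lies in the edge and 0 otherwise, and
  \<open>1 / k\<^sub>f\<close> of the complement is 1 minus the value of the same game for the player choosing edges.
  So the identity is the minimax theorem. As covering numbers are infima, an approximate minimax
  theorem suffices, which follows from Blackwell's regret-matching strategy.
\<close>

section \<open>Approximate minimax by regret matching\<close>

text \<open>Here \<open>w j\<close> counts how often column \<open>j\<close> was played in
  \<open>n\<close> rounds, and row \<open>i\<close> has regret \<open>n * t\<close> minus its
  accumulated payoff. Each round answers the positive parts of the regrets: the response hypothesis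
  makes the cross term in the expanded square nonpositive, so the squared norm of the positive
  regrets grows by at most \<open>K\<close> per round.\<close>

lemma approx_minimax_step:
  fixes A :: "'i \<Rightarrow> 'j \<Rightarrow> real"
  assumes "finite I" and "finite J"
    and response: "\<And>p. (\<And>i. i \<in> I \<Longrightarrow> 0 \<le> p i) \<Longrightarrow> \<exists>j\<in>J. t * (\<Sum>i\<in>I. p i) \<le> (\<Sum>i\<in>I. p i * A i j)"
    and K: "\<And>j. j \<in> J \<Longrightarrow> (\<Sum>i\<in>I. (t - A i j)\<^sup>2) \<le> K"
  shows "\<exists>w. (\<forall>j\<in>J. 0 \<le> w j) \<and> (\<Sum>j\<in>J. w j) = real n \<and>
     (\<Sum>i\<in>I. (max 0 (real n * t - (\<Sum>j\<in>J. w j * A i j)))\<^sup>2) \<le> real n * K"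
proof (induction n)
  case 0
  show ?case by (rule exI[of _ "\<lambda>_. 0"]) simp
next
  case (Suc n)
  then obtain w where w0: "\<And>j. j \<in> J \<Longrightarrow> 0 \<le> w j" and w1: "(\<Sum>j\<in>J. w j) = real n"
    and wK: "(\<Sum>i\<in>I. (max 0 (real n * t - (\<Sum>j\<in>J. w j * A i j)))\<^sup>2) \<le> real n * K"
    by blast
  define r where "r i = real n * t - (\<Sum>j\<in>J. w j * A i j)" for i
  obtain k where k: "k \<in> J"
    and k_le: "t * (\<Sum>i\<in>I. max 0 (r i)) \<le> (\<Sum>i\<in>I. max 0 (r i) * A i k)"
    using response[of "\<lambda>i. max 0 (r i)"] by auto
  define w' where "w' j = w j + (if j = k then 1 else 0)" for j
  have r': "real (Suc n) * t - (\<Sum>j\<in>J. w' j * A i j) = r i + (t - A i k)" for i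
  proof -
    have "(\<Sum>j\<in>J. w' j * A i j) = (\<Sum>j\<in>J. w j * A i j + (if j = k then A i j else 0))"
      by (intro sum.cong) (auto simp: w'_def algebra_simps)
    also have "\<dots> = (\<Sum>j\<in>J. w j * A i j) + A i k"
      using \<open>finite J\<close> k by (simp add: sum.distrib)
    finally show ?thesis by (simp add: r_def algebra_simps)
  qed
  \<comment> \<open>The right side is the square of \<open>max 0 a + d\<close>, which dominates
    \<open>a + d\<close>; if \<open>a + d\<close> is not positive, the left side vanishes.\<close>
  have square: "(max 0 (a + d))\<^sup>2 \<le> (max 0 a)\<^sup>2 + 2 * (max 0 a * d) + d\<^sup>2" for a d :: real
  proof -
    have "(max 0 (a + d))\<^sup>2 \<le> (max 0 a + d)\<^sup>2"
    proof (cases "a + d \<le> 0")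
      case False
      then show ?thesis by (intro power_mono) auto
    qed simp
    then show ?thesis by (simp add: power2_eq_square algebra_simps)
  qed
  have "(\<Sum>i\<in>I. (max 0 (r i + (t - A i k)))\<^sup>2)
      \<le> (\<Sum>i\<in>I. (max 0 (r i))\<^sup>2 + 2 * (max 0 (r i) * (t - A i k)) + (t - A i k)\<^sup>2)"
    by (intro sum_mono square)
  also have "\<dots> = (\<Sum>i\<in>I. (max 0 (r i))\<^sup>2) + 2 * (\<Sum>i\<in>I. max 0 (r i) * (t - A i k))
      + (\<Sum>i\<in>I. (t - A i k)\<^sup>2)"
    by (simp add: sum.distrib sum_distrib_left)
  also have "(\<Sum>i\<in>I. max 0 (r i) * (t - A i k))
      = t * (\<Sum>i\<in>I. max 0 (r i)) - (\<Sum>i\<in>I. max 0 (r i) * A i k)"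
    by (simp add: sum_subtractf sum_distrib_left algebra_simps)
  finally have "(\<Sum>i\<in>I. (max 0 (r i + (t - A i k)))\<^sup>2) \<le> real (Suc n) * K"
    using k_le K[OF k] wK[folded r_def] by (simp add: distrib_right)
  moreover have "(\<Sum>j\<in>J. w' j) = real (Suc n)"
    using \<open>finite J\<close> k w1 by (simp add: w'_def sum.distrib)
  moreover have "\<forall>j\<in>J. 0 \<le> w' j"
    using w0 by (simp add: w'_def)
  ultimately show ?case
    unfolding r'[symmetric] by blast
qed

text \<open>After \<open>n\<close> rounds every regret is at most the square root of
  \<open>n * K\<close>, so the averaged play falls short of \<open>t\<close> by at most the square
  root of \<open>K / n\<close>, which is at most \<epsilon> once \<open>n\<close> reaches
  \<open>K / \<epsilon>\<^sup>2\<close>.\<close>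

lemma approx_minimax:
  fixes A :: "'i \<Rightarrow> 'j \<Rightarrow> real"
  assumes "finite I" and "finite J" and "0 < \<epsilon>"
    and response: "\<And>p. (\<And>i. i \<in> I \<Longrightarrow> 0 \<le> p i) \<Longrightarrow> \<exists>j\<in>J. t * (\<Sum>i\<in>I. p i) \<le> (\<Sum>i\<in>I. p i * A i j)"
  obtains w where "\<And>j. j \<in> J \<Longrightarrow> 0 \<le> w j" and "(\<Sum>j\<in>J. w j) = 1"
    and "\<And>i. i \<in> I \<Longrightarrow> t - \<epsilon> \<le> (\<Sum>j\<in>J. w j * A i j)"
proof -
  \<comment> \<open>Any bound uniform in the column will do; the sum over all columns is a
    convenient one.\<close>
  define K where "K = (\<Sum>j\<in>J. \<Sum>i\<in>I. (t - A i j)\<^sup>2)"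
  have K: "(\<Sum>i\<in>I. (t - A i j)\<^sup>2) \<le> K" if "j \<in> J" for j
    unfolding K_def using that \<open>finite J\<close> by (intro member_le_sum) (auto intro: sum_nonneg)
  obtain n0 :: nat where n0: "K / \<epsilon>\<^sup>2 < real n0"
    using reals_Archimedean2 by blast
  \<comment> \<open>The successor makes \<open>n\<close> positive outright, with no appeal to the
    sign of \<open>K\<close>.\<close>
  define n where "n = Suc n0"
  have "K / \<epsilon>\<^sup>2 \<le> real n" using n0 by (simp add: n_def)
  then have n: "0 < real n" "K \<le> real n * \<epsilon>\<^sup>2"
    using \<open>0 < \<epsilon>\<close> by (simp_all add: n_def pos_divide_le_eq)
  obtain w where w0: "\<And>j. j \<in> J \<Longrightarrow> 0 \<le> w j" and w1: "(\<Sum>j\<in>J. w j) = real n"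
    and wK: "(\<Sum>i\<in>I. (max 0 (real n * t - (\<Sum>j\<in>J. w j * A i j)))\<^sup>2) \<le> real n * K"
    using approx_minimax_step[OF assms(1,2) response K, of n] by blast
  have regret: "real n * t - (\<Sum>j\<in>J. w j * A i j) \<le> real n * \<epsilon>" if "i \<in> I" for i
  proof -
    have "(max 0 (real n * t - (\<Sum>j\<in>J. w j * A i j)))\<^sup>2
        \<le> (\<Sum>i\<in>I. (max 0 (real n * t - (\<Sum>j\<in>J. w j * A i j)))\<^sup>2)"
      using that \<open>finite I\<close> by (intro member_le_sum) auto
    also have "\<dots> \<le> real n * K" by (rule wK)
    also have "\<dots> \<le> real n * (real n * \<epsilon>\<^sup>2)" using n by (intro mult_left_mono) auto
    also have "\<dots> = (real n * \<epsilon>)\<^sup>2" by (simp add: power2_eq_square)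
    finally have "max 0 (real n * t - (\<Sum>j\<in>J. w j * A i j)) \<le> real n * \<epsilon>"
      using \<open>0 < \<epsilon>\<close> by (auto intro: power2_le_imp_le)
    then show ?thesis by simp
  qed
  show ?thesis
  proof
    show "0 \<le> w j / real n" if "j \<in> J" for j using w0[OF that] by simp
    show "(\<Sum>j\<in>J. w j / real n) = 1" using w1 n by (simp flip: sum_divide_distrib)
    show "t - \<epsilon> \<le> (\<Sum>j\<in>J. w j / real n * A i j)" if "i \<in> I" for i
    proof -
      have "(t - \<epsilon>) * real n \<le> (\<Sum>j\<in>J. w j * A i j)"
        using regret[OF that] by (simp add: algebra_simps)
      then have "t - \<epsilon> \<le> (\<Sum>j\<in>J. w j * A i j) / real n"
        using n(1) by (simp add: pos_le_divide_eq)
      then show ?thesis by (simp add: sum_divide_distrib)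
    qed
  qed
qed

section \<open>Covering programs of an incidence relation\<close>

text \<open>The attainable objective values of a covering program with variables in \<open>I\<close>
  and constraints in \<open>V\<close>. With an abstract relation, the dual and the complement become
  programs over the same two sets, with roles exchanged and the relation negated.\<close>

definition cover_values :: "'i set \<Rightarrow> 'v set \<Rightarrow> ('i \<Rightarrow> 'v \<Rightarrow> bool) \<Rightarrow> real set" where
  "cover_values I V R = {\<Sum>i\<in>I. x i | x.
     (\<forall>i\<in>I. 0 \<le> x i) \<and> (\<forall>v\<in>V. 1 \<le> (\<Sum>i\<in>{i\<in>I. R i v}. x i))}"

lemma cover_values_cong:
  assumes "\<And>i v. i \<in> I \<Longrightarrow> v \<in> V \<Longrightarrow> R i v = R' i v"
  shows "cover_values I V R = cover_values I V R'"
proof -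
  have "{i\<in>I. R i v} = {i\<in>I. R' i v}" if "v \<in> V" for v
    using assms that by auto
  then show ?thesis
    unfolding cover_values_def by simp
qed

lemma cover_values_ge_1:
  assumes "finite I" and "V \<noteq> {}" and "s \<in> cover_values I V R"
  shows "1 \<le> s"
proof -
  obtain v x where v: "v \<in> V" and x: "s = (\<Sum>i\<in>I. x i)" "\<forall>i\<in>I. 0 \<le> x i"
    "1 \<le> (\<Sum>i\<in>{i\<in>I. R i v}. x i)"
    using assms by (auto simp: cover_values_def)
  have "(\<Sum>i\<in>{i\<in>I. R i v}. x i) \<le> s"
    unfolding x(1) using assms(1) x(2) by (intro sum_mono2) auto
  with x(3) show ?thesis by simp
qed

lemma bdd_below_cover_values: "finite I \<Longrightarrow> V \<noteq> {} \<Longrightarrow> bdd_below (cover_values I V R)"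
  using cover_values_ge_1 by (metis bdd_belowI)

lemma cover_values_nonempty:
  assumes "finite I" and "\<And>v. v \<in> V \<Longrightarrow> \<exists>i\<in>I. R i v"
  shows "cover_values I V R \<noteq> {}"
proof -
  have "1 \<le> (\<Sum>i\<in>{i\<in>I. R i v}. 1 :: real)" if v: "v \<in> V" for v
  proof -
    have "{i\<in>I. R i v} \<noteq> {}" using assms(2)[OF v] by auto
    then have "0 < card {i\<in>I. R i v}" using assms(1) by (simp add: card_gt_0_iff)
    then show ?thesis by simp
  qed
  then have "(\<Sum>i\<in>I. 1) \<in> cover_values I V R"
    unfolding cover_values_def by (intro CollectI exI[of _ "\<lambda>_. 1"]) auto
  then show ?thesis by blast
qed

text \<open>The passage from strategies to covers: a distribution guaranteeing payoff
  \<open>s\<close> yields a cover of value \<open>1 / s\<close>.\<close>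

lemma cover_values_scaled:
  assumes "0 < s" and "\<And>i. i \<in> I \<Longrightarrow> 0 \<le> x i"
    and "\<And>v. v \<in> V \<Longrightarrow> s \<le> (\<Sum>i\<in>{i\<in>I. R i v}. x i)"
  shows "(\<Sum>i\<in>I. x i) / s \<in> cover_values I V R"
  unfolding cover_values_def using assms
  by (intro CollectI exI[of _ "\<lambda>i. x i / s"]) (auto simp flip: sum_divide_distrib)

section \<open>Duality between a relation and its negation\<close>

lemma sum_filter_of_bool:
  fixes x :: "'i \<Rightarrow> real"
  shows "finite I \<Longrightarrow> (\<Sum>i\<in>{i\<in>I. P i}. x i) = (\<Sum>i\<in>I. x i * of_bool (P i))"
  by (simp add: sum.inter_filter of_bool_def if_distrib cong: if_cong)

text \<open>The product \<open>a * b\<close> is the sum of \<open>y v * x i\<close> over all pairs.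
  Pairs outside \<open>R\<close> contribute at least \<open>a\<close>, because \<open>x\<close>
  covers every \<open>v\<close>; pairs in \<open>R\<close> contribute at least \<open>b\<close>,
  because \<open>y\<close> covers every \<open>i\<close>. For positive values this says that the
  reciprocals sum to at most 1.\<close>

lemma cover_values_weak_duality:
  assumes "finite I" and "finite V"
    and "a \<in> cover_values V I (\<lambda>v i. R i v)" and "b \<in> cover_values I V (\<lambda>i v. \<not> R i v)"
  shows "a + b \<le> a * b"
proof -
  obtain y where y: "a = (\<Sum>v\<in>V. y v)" "\<forall>v\<in>V. 0 \<le> y v"
    "\<forall>i\<in>I. 1 \<le> (\<Sum>v\<in>V. y v * of_bool (R i v))"
    using assms(2,3) by (auto simp: cover_values_def sum_filter_of_bool)
  obtain x where x: "b = (\<Sum>i\<in>I. x i)" "\<forall>i\<in>I. 0 \<le> x i"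
    "\<forall>v\<in>V. 1 \<le> (\<Sum>i\<in>I. x i * of_bool (\<not> R i v))"
    using assms(1,4) unfolding cover_values_def sum_filter_of_bool[OF assms(1)] by auto
  have "a + b = (\<Sum>v\<in>V. y v * 1) + (\<Sum>i\<in>I. x i * 1)"
    using x(1) y(1) by simp
  also have "\<dots> \<le> (\<Sum>v\<in>V. y v * (\<Sum>i\<in>I. x i * of_bool (\<not> R i v)))
      + (\<Sum>i\<in>I. x i * (\<Sum>v\<in>V. y v * of_bool (R i v)))"
    using x y by (intro add_mono sum_mono mult_left_mono) auto
  also have "(\<Sum>i\<in>I. x i * (\<Sum>v\<in>V. y v * of_bool (R i v)))
      = (\<Sum>v\<in>V. \<Sum>i\<in>I. x i * (y v * of_bool (R i v)))"
    unfolding sum_distrib_left by (rule sum.swap)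
  also have "(\<Sum>v\<in>V. y v * (\<Sum>i\<in>I. x i * of_bool (\<not> R i v))) + \<dots> = (\<Sum>v\<in>V. \<Sum>i\<in>I. y v * x i)"
    unfolding sum_distrib_left sum.distrib[symmetric]
    by (intro sum.cong) (auto simp: algebra_simps)
  also have "\<dots> = a * b"
    using x(1) y(1) by (simp add: sum_product)
  finally show ?thesis .
qed

text \<open>Otherwise some \<open>t\<close> lies strictly between \<open>1 / a\<close> and
  \<open>1 - 1 / b\<close>. If some weighting \<open>p\<close> of \<open>I\<close> keeps every
  column below \<open>t\<close>, then \<open>p\<close> rescales to a cover for the negated relation
  of value \<open>1 / (1 - t)\<close>, which is less than \<open>b\<close>. If not, minimax yields a
  weighting of \<open>V\<close> that rescales to a cover of value less than
  \<open>a\<close>.\<close>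

lemma inverse_cover_values_ge_1:
  fixes R :: "'i \<Rightarrow> 'v \<Rightarrow> bool"
  assumes "finite I" and "finite V" and "V \<noteq> {}" and "0 < a" and "0 < b"
    and a: "\<And>s. s \<in> cover_values V I (\<lambda>v i. R i v) \<Longrightarrow> a \<le> s"
    and b: "\<And>s. s \<in> cover_values I V (\<lambda>i v. \<not> R i v) \<Longrightarrow> b \<le> s"
  shows "1 \<le> 1 / a + 1 / b"
proof (rule ccontr)
  assume "\<not> ?thesis"
  then have "1 / a < 1 - 1 / b" by simp
  then obtain t where t: "1 / a < t" "t < 1 - 1 / b"
    using dense by blast
  \<comment> \<open>The gap \<open>t - u\<close> is the error granted to the approximate minimax
    theorem.\<close>
  obtain u where u: "1 / a < u" "u < t"
    using dense[OF t(1)] by blast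
  have pos: "0 < 1 / a" "0 < 1 / b" using \<open>0 < a\<close> \<open>0 < b\<close> by auto
  have "0 < u" using pos(1) u(1) by (rule less_trans)
  have "\<exists>v\<in>V. t * (\<Sum>i\<in>I. p i) \<le> (\<Sum>i\<in>I. p i * of_bool (R i v))"
    if p: "\<And>i. i \<in> I \<Longrightarrow> 0 \<le> p i" for p
  proof (rule ccontr)
    assume "\<not> ?thesis"
    then have less: "(\<Sum>i\<in>I. p i * of_bool (R i v)) < t * (\<Sum>i\<in>I. p i)" if "v \<in> V" for v
      using that by force
    \<comment> \<open>One column suffices to see that \<open>p\<close> has positive total: its
      payoff is nonnegative and strictly below \<open>t\<close> times that total.\<close>
    obtain v where "v \<in> V" using \<open>V \<noteq> {}\<close> by blast
    then have "0 < t * (\<Sum>i\<in>I. p i)"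
      using less p by (intro le_less_trans[OF sum_nonneg less]) auto
    then have P: "0 < (\<Sum>i\<in>I. p i)"
      using t pos by (simp add: zero_less_mult_iff)
    have "(1 - t) * (\<Sum>i\<in>I. p i) \<le> (\<Sum>i\<in>{i\<in>I. \<not> R i v}. p i)" if "v \<in> V" for v
    proof -
      have "(\<Sum>i\<in>I. p i * of_bool (R i v)) + (\<Sum>i\<in>I. p i * of_bool (\<not> R i v)) = (\<Sum>i\<in>I. p i)"
        unfolding sum.distrib[symmetric] by (intro sum.cong) auto
      then show ?thesis
        using less[OF that] unfolding sum_filter_of_bool[OF \<open>finite I\<close>] by (simp add: algebra_simps)
    qed
    moreover have "0 < (1 - t) * (\<Sum>i\<in>I. p i)"
      using P t pos by (intro mult_pos_pos) linarith+
    ultimately have "(\<Sum>i\<in>I. p i) / ((1 - t) * (\<Sum>i\<in>I. p i)) \<in> cover_values I V (\<lambda>i v. \<not> R i v)"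
      using p by (intro cover_values_scaled) auto
    then have "b \<le> 1 / (1 - t)" using b P by force
    then show False using t pos \<open>0 < b\<close> by (simp add: field_simps)
  qed
  then obtain w where w: "\<And>v. v \<in> V \<Longrightarrow> 0 \<le> w v" "(\<Sum>v\<in>V. w v) = 1"
    "\<And>i. i \<in> I \<Longrightarrow> t - (t - u) \<le> (\<Sum>v\<in>V. w v * of_bool (R i v))"
    using approx_minimax[of I V "t - u" t "\<lambda>i v. of_bool (R i v)"] assms(1,2) u by auto
  then have "(\<Sum>v\<in>V. w v) / u \<in> cover_values V I (\<lambda>v i. R i v)"
    using \<open>0 < u\<close> unfolding sum_filter_of_bool[OF \<open>finite V\<close>, symmetric]
    by (intro cover_values_scaled) auto
  then have "a \<le> 1 / u" using a w(2) by force
  then show False using u \<open>0 < u\<close> \<open>0 < a\<close> by (simp add: field_simps)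
qed

text \<open>Weak duality has to be carried from single values to the infima, which need not be known
  to be attained. It is solved for one value at a time, taking the infimum over \<open>?B\<close>
  first and over \<open>?A\<close> second.\<close>

lemma inverse_Inf_cover_values:
  fixes R :: "'i \<Rightarrow> 'v \<Rightarrow> bool"
  assumes "finite I" and "finite V" and "I \<noteq> {}" and "V \<noteq> {}"
    and "\<And>i. i \<in> I \<Longrightarrow> \<exists>v\<in>V. R i v" and "\<And>v. v \<in> V \<Longrightarrow> \<exists>i\<in>I. \<not> R i v"
  defines "a \<equiv> Inf (cover_values V I (\<lambda>v i. R i v))"
    and "b \<equiv> Inf (cover_values I V (\<lambda>i v. \<not> R i v))"
  shows "1 \<le> a" and "1 \<le> b" and "1 / a + 1 / b = 1"
proof -
  let ?A = "cover_values V I (\<lambda>v i. R i v)" and ?B = "cover_values I V (\<lambda>i v. \<not> R i v)"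
  have ne: "?A \<noteq> {}" "?B \<noteq> {}"
    using assms(1,2,5,6) by (intro cover_values_nonempty; blast)+
  show a: "1 \<le> a" and b: "1 \<le> b"
    unfolding a_def b_def using ne assms
    by (auto intro!: cInf_greatest intro: cover_values_ge_1)
  have lower: "a \<le> s" if "s \<in> ?A" for s
    unfolding a_def using that assms by (intro cInf_lower bdd_below_cover_values)
  have lower': "b \<le> s" if "s \<in> ?B" for s
    unfolding b_def using that assms by (intro cInf_lower bdd_below_cover_values)
  \<comment> \<open>In this factored form either value can be isolated by a division.\<close>
  have weak: "1 \<le> (s - 1) * (s' - 1)" if "s \<in> ?A" "s' \<in> ?B" for s s'
    using cover_values_weak_duality[OF assms(1,2) that] by (simp add: algebra_simps)
  have gt: "1 < s" if "s \<in> ?A" for s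
  proof -
    obtain s' where s': "s' \<in> ?B" using ne by blast
    have "1 \<le> s" using that assms by (intro cover_values_ge_1)
    moreover have "s \<noteq> 1" using weak[OF that s'] by auto
    ultimately show ?thesis by simp
  qed
  have *: "1 / (s - 1) + 1 \<le> b" if s: "s \<in> ?A" for s
    unfolding b_def
  proof (rule cInf_greatest[OF ne(2)])
    fix s' assume "s' \<in> ?B"
    with weak[OF s] gt[OF s] show "1 / (s - 1) + 1 \<le> s'"
      by (simp add: field_simps)
  qed
  \<comment> \<open>Values above 1 could still have infimum 1; strictness comes from a fixed
    \<open>s\<close> and permits the division by \<open>b - 1\<close> below.\<close>
  have "1 < b"
  proof -
    obtain s where s: "s \<in> ?A" using ne by blast
    have "0 < 1 / (s - 1)" using gt[OF s] by simp
    then show ?thesis using *[OF s] by linarith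
  qed
  have "1 / (b - 1) + 1 \<le> a"
    unfolding a_def
  proof (rule cInf_greatest[OF ne(1)])
    fix s assume "s \<in> ?A"
    from *[OF this] gt[OF this] \<open>1 < b\<close> show "1 / (b - 1) + 1 \<le> s"
      by (simp add: field_simps)
  qed
  then have "1 / a + 1 / b \<le> 1"
    using \<open>1 < b\<close> a by (simp add: field_simps)
  moreover have "1 \<le> 1 / a + 1 / b"
    using assms(1,2,4) a b lower lower' by (intro inverse_cover_values_ge_1[of I V a b R]) auto
  ultimately show "1 / a + 1 / b = 1" by simp
qed

section \<open>Indexing the edges of a hypergraph\<close>

text \<open>The multiplicity of \<open>e\<close> is the size of its fibre under \<open>f\<close>, so
  any enumeration of each fibre matches the indices with the numbered copies of
  \<open>e\<close>.\<close>

lemma bij_betw_occurrences: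
  assumes "finite I" and "edges G = image_mset f (mset_set I)"
  obtains g where "bij_betw g I (occurrences G)" and "\<And>i. i \<in> I \<Longrightarrow> fst (g i) = f i"
proof -
  define F where "F e = {i\<in>I. f i = e}" for e
  have "\<exists>h. bij_betw h (F e) {0..<card (F e)}" for e
    using assms(1) by (intro ex_bij_betw_finite_nat) (simp add: F_def)
  then obtain h where h: "\<And>e. bij_betw (h e) (F e) {0..<card (F e)}"
    by metis
  have count: "count (edges G) e = card (F e)" for e
  proof -
    have "F e = f -` {e} \<inter> I" by (auto simp: F_def)
    then show ?thesis using assms by (simp add: count_image_mset)
  qed
  define g where "g i = (f i, h (f i) i)" for i
  have "bij_betw g I (occurrences G)"
    unfolding bij_betw_def
  proof
    show "inj_on g I"
    proof (rule inj_onI)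
      fix i j assume "i \<in> I" "j \<in> I" "g i = g j"
      then show "i = j"
        using bij_betw_imp_inj_on[OF h[of "f j"]] by (auto simp: g_def F_def dest: inj_onD)
    qed
    have "g ` I = (\<Union>e. Pair e ` h e ` F e)"
      by (auto simp: g_def F_def)
    also have "\<dots> = occurrences G"
      unfolding bij_betw_imp_surj_on[OF h] by (force simp: occurrences_def count)
    finally show "g ` I = occurrences G" .
  qed
  then show ?thesis using that by (simp add: g_def)
qed

text \<open>The numbering of copies does not affect the program, so the variables may be indexed by
  whatever set produced the edges: vertices for the dual, occurrences for the complement.\<close>

lemma fractional_covering_number_indexed:
  assumes "finite I" and "edges G = image_mset f (mset_set I)"
  shows "fractional_covering_number G =
    (INF s \<in> cover_values I (verts G) (\<lambda>i v. v \<in> f i). ereal s)"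
proof -
  obtain g where g: "bij_betw g I (occurrences G)" and f: "\<And>i. i \<in> I \<Longrightarrow> fst (g i) = f i"
    using bij_betw_occurrences[OF assms] by blast
  have total: "(\<Sum>c\<in>occurrences G. x c) = (\<Sum>i\<in>I. x (g i))" for x :: "_ \<Rightarrow> real"
    using sum.reindex_bij_betw[OF g, of x] by simp
  have local: "(\<Sum>c\<in>{c\<in>occurrences G. v \<in> fst c}. x c) = (\<Sum>i\<in>{i\<in>I. v \<in> f i}. x (g i))"
    for x :: "_ \<Rightarrow> real" and v
  proof -
    have "bij_betw g {i\<in>I. v \<in> f i} (g ` {i\<in>I. v \<in> f i})"
      using g by (rule bij_betw_subset) auto
    also have "g ` {i\<in>I. v \<in> f i} = {c\<in>occurrences G. v \<in> fst c}"
      unfolding bij_betw_imp_surj_on[OF g, symmetric] using f by auto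
    finally have "bij_betw g {i\<in>I. v \<in> f i} {c\<in>occurrences G. v \<in> fst c}" .
    from sum.reindex_bij_betw[OF this, of x] show ?thesis by simp
  qed
  have cover: "fractional_cover G x \<longleftrightarrow>
      (\<forall>v\<in>verts G. 1 \<le> (\<Sum>i\<in>{i\<in>I. v \<in> f i}. x (g i))) \<and> (\<forall>i\<in>I. 0 \<le> x (g i))" for x
    unfolding fractional_cover_def local by (simp flip: bij_betw_imp_surj_on[OF g])
  have "(\<lambda>x. \<Sum>c\<in>occurrences G. x c) ` {x. fractional_cover G x}
      = cover_values I (verts G) (\<lambda>i v. v \<in> f i)" (is "?L = ?R")
  proof
    show "?L \<subseteq> ?R"
      unfolding cover_values_def
    proof clarify
      fix x assume "fractional_cover G x"
      then show "\<exists>y. (\<Sum>c\<in>occurrences G. x c) = (\<Sum>i\<in>I. y i) \<and> (\<forall>i\<in>I. 0 \<le> y i) \<and>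
          (\<forall>v\<in>verts G. 1 \<le> (\<Sum>i\<in>{i\<in>I. v \<in> f i}. y i))"
        by (intro exI[of _ "\<lambda>i. x (g i)"]) (simp add: cover total)
    qed
    show "?R \<subseteq> ?L"
    proof
      fix s assume "s \<in> ?R"
      then obtain y where s: "s = (\<Sum>i\<in>I. y i)" and y: "\<forall>i\<in>I. 0 \<le> y i"
        "\<forall>v\<in>verts G. 1 \<le> (\<Sum>i\<in>{i\<in>I. v \<in> f i}. y i)"
        by (auto simp: cover_values_def)
      \<comment> \<open>Off the occurrences \<open>x\<close> is arbitrary, but neither the
        constraints nor the objective look there.\<close>
      define x where "x = y \<circ> inv_into I g"
      have x: "x (g i) = y i" if "i \<in> I" for i
        using that g by (simp add: x_def bij_betw_inv_into_left)
      have "fractional_cover G x" "(\<Sum>c\<in>occurrences G. x c) = s"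
        unfolding cover total using x y s by simp_all
      then show "s \<in> ?L" by auto
    qed
  qed
  then show ?thesis
    unfolding fractional_covering_number_def by (simp add: image_image flip: \<open>?L = ?R\<close>)
qed

text \<open>This lets the edges of the complement be indexed by occurrences of \<open>H\<close>,
  which are also the vertices of the dual.\<close>

lemma image_mset_fst_occurrences: "image_mset fst (mset_set (occurrences H)) = edges H"
proof (rule multiset_eqI)
  fix e
  have "fst -` {e} \<inter> occurrences H = Pair e ` {..<count (edges H) e}"
    unfolding occurrences_def by force
  then have "card (fst -` {e} \<inter> occurrences H) = count (edges H) e"
    by (simp add: card_image inj_on_def)
  then show "count (image_mset fst (mset_set (occurrences H))) e = count (edges H) e"
    by (simp add: count_image_mset finite_occurrences)
qed

text \<open>Without vertices, \<open>H\<close> could have no edge either; both covering numbers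
  would be 0 and the identity would fail, hence the assumption that \<open>verts H\<close> is
  nonempty.\<close>

theorem theorem2:
  fixes H :: "'v hypergraph"
  assumes "hypergraph H" and "nontrivial H" and "verts H \<noteq> {}"
  shows "1 / fractional_covering_number (dual H)
       + 1 / fractional_covering_number (complement H) = 1"
proof -
  let ?I = "occurrences H" and ?V = "verts H" and ?R = "\<lambda>c v. v \<in> fst c"
  let ?A = "cover_values ?V ?I (\<lambda>v c. ?R c v)" and ?B = "cover_values ?I ?V (\<lambda>c v. \<not> ?R c v)"
  have fin: "finite ?I" "finite ?V"
    using assms(1) by (auto simp: finite_occurrences hypergraph_def)
  have set_edges: "set_mset (edges H) = fst ` ?I"
    unfolding image_mset_fst_occurrences[symmetric] using fin by simp
  have ne: "\<exists>v\<in>?V. ?R c v" if "c \<in> ?I" for c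
  proof -
    have "fst c \<in># edges H" using that set_edges by simp
    then show ?thesis using assms(1,2) by (metis all_not_in_conv hypergraph_def nontrivial_def subsetD)
  qed
  have missed: "\<exists>c\<in>?I. \<not> ?R c v" if "v \<in> ?V" for v
    using that assms(2) by (auto simp: nontrivial_def universal_def set_edges)
  \<comment> \<open>A vertex that is not universal is missed by some edge, so an edge
    exists.\<close>
  have "?I \<noteq> {}" using missed assms(3) by blast
  note game = inverse_Inf_cover_values[of ?I ?V ?R, OF fin \<open>?I \<noteq> {}\<close> assms(3) ne missed]
  have "fractional_covering_number (dual H) = (INF s \<in> ?A. ereal s)"
  proof -
    have "fractional_covering_number (dual H) =
        (INF s \<in> cover_values ?V (verts (dual H)) (\<lambda>v c. c \<in> {c \<in> ?I. v \<in> fst c}). ereal s)"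
      by (intro fractional_covering_number_indexed fin) (simp add: dual_def)
    also have "cover_values ?V (verts (dual H)) (\<lambda>v c. c \<in> {c \<in> ?I. v \<in> fst c}) = ?A"
      unfolding dual_def hypergraph.sel by (rule cover_values_cong) simp
    finally show ?thesis .
  qed
  \<comment> \<open>Feasibility and the lower bound 1 make the extended infimum a real one;
    feasibility holds because no edge of \<open>H\<close> is empty.\<close>
  also have "\<dots> = ereal (Inf ?A)"
    using fin \<open>?I \<noteq> {}\<close> ne
    by (intro ereal_Inf'[symmetric] bdd_below_cover_values cover_values_nonempty)
  finally have dual: "fractional_covering_number (dual H) = ereal (Inf ?A)" .
  have "fractional_covering_number (complement H) = (INF s \<in> ?B. ereal s)"
  proof -
    have "edges (complement H) = image_mset (\<lambda>c. ?V - fst c) (mset_set ?I)"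
      unfolding complement_def hypergraph.sel image_mset_fst_occurrences[of H, symmetric]
      by (simp add: multiset.map_comp comp_def)
    then have "fractional_covering_number (complement H) =
        (INF s \<in> cover_values ?I (verts (complement H)) (\<lambda>c v. v \<in> ?V - fst c). ereal s)"
      by (intro fractional_covering_number_indexed fin)
    also have "cover_values ?I (verts (complement H)) (\<lambda>c v. v \<in> ?V - fst c) = ?B"
      unfolding complement_def hypergraph.sel by (rule cover_values_cong) simp
    finally show ?thesis .
  qed
  \<comment> \<open>Here feasibility holds because no vertex of \<open>H\<close> is
    universal.\<close>
  also have "\<dots> = ereal (Inf ?B)"
    using fin assms(3) missed
    by (intro ereal_Inf'[symmetric] bdd_below_cover_values cover_values_nonempty)
  finally have complement: "fractional_covering_number (complement H) = ereal (Inf ?B)" .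
  have "1 / ereal (Inf ?A) = ereal (1 / Inf ?A)" "1 / ereal (Inf ?B) = ereal (1 / Inf ?B)"
    using game(1,2) by (auto simp: one_ereal_def)
  then show ?thesis
    unfolding dual complement using game(3) by (simp add: one_ereal_def)
qed

end
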